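(* Let $V=-y\,\partial_x+x\,\partial_y$ on $\mathbb{E}^3\setminus Oz$ and let $F_V=-(x\,dx+y\,dy)\wedge dz$ be the corresponding Killing magnetic field. Every normal magnetic trajectory of $F_V$, i.e. every arc length parametrized curve $\gamma(t)=(x(t),y(t),z(t))$ in $\mathbb{E}^3\setminus Oz$, defined on an interval, satisfying $\gamma''=V\times\gamma'$ (with $V$ evaluated along $\gamma$), is of one of the following types: (a) a planar curve situated in a vertical strip; (b) a circular helix; (c) a curve parametrized by $$x(t)=\rho(t)\cos\phi(t),\qquad y(t)=\rho(t)\sin\phi(t),\qquad z(t)=q_0t-\frac12\int^t\rho^2(\zeta)\,d\zeta,$$ where $q_0$ is a real constant, $\int^t$ denotes an antiderivative, and the functions $\rho>0$ and $\phi$ satisfy $$\left(\frac{d\rho^2}{dt}\right)^2+P\big(\rho^2(t)\big)=0,\qquad \rho^2(t)\,\phi'(t)=\text{constant},$$ with $P$ a real polynomial of degree $3$ (depending on the curve).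
   Context: $\mathbb{E}^3$ is Euclidean 3-space with global coordinates $(x,y,z)$, the usual scalar product $\langle\cdot,\cdot\rangle$, volume form $dv=dx\wedge dy\wedge dz$ and the usual cross product $\times$; $Oz$ is the $z$-axis. A magnetic field is a closed 2-form $F$; its Lorentz force is the $(1,1)$ tensor field $\Phi$ with $\langle\Phi(X),Y\rangle=F(X,Y)$ for all vector fields $X,Y$; its magnetic trajectories (magnetic curves) are the curves $\gamma$ with $\nabla_{\gamma'}\gamma'=\Phi(\gamma')$. They have constant speed, and are called normal when parametrized by arc length. For a Killing vector field $V$ the associated Killing magnetic field is $F_V=\iota_V dv$, with Lorentz force $\Phi(X)=V\times X$. For $V=-y\partial_x+x\partial_y$ the equation $\gamma''=V\times\gamma'$ is the system $x''=xz'$, $y''=yz'$, $z''=-(xx'+yy')$. A vertical strip is the region of a plane parallel to $Oz$ lying between two lines parallel to $Oz$. A circular helix here is a helix on a circular cylinder. *)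

theory Defs
  imports "HOL-Analysis.Analysis" "HOL-Computational_Algebra.Polynomial"
begin

type_synonym vector_field = "real^3 \<Rightarrow> real^3"
type_synonym two_form = "real^3 \<Rightarrow> real^3 \<Rightarrow> real^3 \<Rightarrow> real"

section \<open>Killing magnetic fields on Euclidean 3-space\<close>

definition killing_field :: "vector_field \<Rightarrow> bool" where
  "killing_field V \<longleftrightarrow>
     (\<forall>p. \<exists>D. (V has_derivative D) (at p) \<and> (\<forall>X Y. D X \<bullet> Y + X \<bullet> D Y = 0))"

text \<open>The volume form \<open>dx \<and> dy \<and> dz\<close>, normalised to be 1 on the standard basis.\<close>

definition volume_form :: "real^3 \<Rightarrow> real^3 \<Rightarrow> real^3 \<Rightarrow> real" where
  "volume_form X Y Z = det (vector [X, Y, Z])"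

definition killing_magnetic_field :: "vector_field \<Rightarrow> two_form" where
  "killing_magnetic_field V p X Y = volume_form (V p) X Y"

definition lorentz_force :: "two_form \<Rightarrow> real^3 \<Rightarrow> real^3 \<Rightarrow> real^3" where
  "lorentz_force F p X = (THE W. \<forall>Y. W \<bullet> Y = F p X Y)"

lemma lorentz_force_killing_magnetic_field:
  "lorentz_force (killing_magnetic_field V) p X = cross3 (V p) X"
  unfolding lorentz_force_def
proof (rule the_equality)
  show cross: "\<forall>Y. cross3 (V p) X \<bullet> Y = killing_magnetic_field V p X Y"
    by (simp add: killing_magnetic_field_def volume_form_def cross3_simps)
  fix W assume "\<forall>Y. W \<bullet> Y = killing_magnetic_field V p X Y"
  with cross have "\<forall>Y. W \<bullet> Y = cross3 (V p) X \<bullet> Y" by simp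
  then show "W = cross3 (V p) X" using vector_eq_rdot by blast
qed

text \<open>
  Both derivatives are taken within the parameter interval \<open>I\<close>, hence are one-sided at the
  endpoints belonging to \<open>I\<close>; they are unique as soon as \<open>I\<close> is nondegenerate.
\<close>

definition normal_magnetic_trajectory :: "two_form \<Rightarrow> real set \<Rightarrow> (real \<Rightarrow> real^3) \<Rightarrow> bool" where
  "normal_magnetic_trajectory F I \<gamma> \<longleftrightarrow>
     (\<exists>\<gamma>'. \<forall>t\<in>I.
        (\<gamma> has_vector_derivative \<gamma>' t) (at t within I) \<and>
        (\<gamma>' has_vector_derivative lorentz_force F (\<gamma> t) (\<gamma>' t)) (at t within I) \<and>
        norm (\<gamma>' t) = 1)"

section \<open>The rotational field about the vertical axis\<close>

definition vertical_line :: "real^3 \<Rightarrow> (real^3) set" where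
  "vertical_line p = {p + h *\<^sub>R axis 3 1 | h. True}"

definition Oz :: "(real^3) set" where
  "Oz = vertical_line 0"

definition rotation_field :: vector_field where
  "rotation_field p = vector [- (p $ 2), p $ 1, 0]"

lemma killing_field_rotation_field: "killing_field rotation_field"
  unfolding killing_field_def
proof (intro allI exI conjI)
  have "linear rotation_field"
    by (rule linearI) (simp_all add: rotation_field_def vec_eq_iff forall_3 vector_def)
  then show "(rotation_field has_derivative rotation_field) (at p)" for p
    by (simp add: linear_imp_has_derivative)
  show "rotation_field X \<bullet> Y + X \<bullet> rotation_field Y = 0" for X Y
    by (simp add: rotation_field_def inner_vec_def sum_3 vector_def algebra_simps)
qed

text \<open>\<open>F\<^sub>V = - (x dx + y dy) \<and> dz\<close>\<close>

lemma killing_magnetic_field_rotation_field: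
  "killing_magnetic_field rotation_field p X Y =
     - ((p $ 1 * X $ 1 + p $ 2 * X $ 2) * Y $ 3 - (p $ 1 * Y $ 1 + p $ 2 * Y $ 2) * X $ 3)"
  by (simp add: killing_magnetic_field_def volume_form_def rotation_field_def det_3 vector_def
      algebra_simps)

section \<open>Types of curves\<close>

text \<open>
  The region between two distinct vertical lines, boundary included, is their convex hull; it lies
  in the plane spanned by them.
\<close>

definition vertical_strip :: "(real^3) set \<Rightarrow> bool" where
  "vertical_strip S \<longleftrightarrow>
     (\<exists>p q. vertical_line p \<noteq> vertical_line q \<and>
            S = convex hull (vertical_line p \<union> vertical_line q))"

definition planar_curve_in_vertical_strip :: "real set \<Rightarrow> (real \<Rightarrow> real^3) \<Rightarrow> bool" where
  "planar_curve_in_vertical_strip I \<gamma> \<longleftrightarrow> (\<exists>S. vertical_strip S \<and> \<gamma> ` I \<subseteq> S)"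

text \<open>
  A helix on the circular cylinder of radius \<open>r\<close> whose axis passes through \<open>c\<close> with direction \<open>w\<close>.
  Arbitrary axes and both orientations are allowed; \<open>\<omega> \<noteq> 0\<close> and \<open>h \<noteq> 0\<close> exclude the degenerate
  cases of straight lines and circles. The parameter is proportional to arc length.
\<close>

definition circular_helix :: "real set \<Rightarrow> (real \<Rightarrow> real^3) \<Rightarrow> bool" where
  "circular_helix I \<gamma> \<longleftrightarrow>
     (\<exists>c u v w r \<omega> \<theta> h.
        norm u = 1 \<and> norm v = 1 \<and> norm w = 1 \<and> u \<bullet> v = 0 \<and> u \<bullet> w = 0 \<and> v \<bullet> w = 0 \<and>
        r > 0 \<and> \<omega> \<noteq> 0 \<and> h \<noteq> 0 \<and>
        (\<forall>t\<in>I. \<gamma> t = c + (r * cos (\<omega> * t + \<theta>)) *\<^sub>R u + (r * sin (\<omega> * t + \<theta>)) *\<^sub>R v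
                        + (h * t) *\<^sub>R w))"

text \<open>Here \<open>R\<close> is the antiderivative of \<open>\<rho>\<^sup>2\<close>.\<close>

definition polar_type_curve :: "real set \<Rightarrow> (real \<Rightarrow> real^3) \<Rightarrow> bool" where
  "polar_type_curve I \<gamma> \<longleftrightarrow>
     (\<exists>(\<rho> :: real \<Rightarrow> real) (\<phi> :: real \<Rightarrow> real) (R :: real \<Rightarrow> real) (q0 :: real)
       (P :: real poly) (c :: real).
        degree P = 3 \<and>
        (\<forall>t\<in>I.
           \<rho> t > 0 \<and>
           \<gamma> t $ 1 = \<rho> t * cos (\<phi> t) \<and>
           \<gamma> t $ 2 = \<rho> t * sin (\<phi> t) \<and>
           (R has_real_derivative (\<rho> t)\<^sup>2) (at t within I) \<and>
           \<gamma> t $ 3 = q0 * t - R t / 2 \<and>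
           (\<exists>D. ((\<lambda>s. (\<rho> s)\<^sup>2) has_real_derivative D) (at t within I) \<and>
                D\<^sup>2 + poly P ((\<rho> t)\<^sup>2) = 0) \<and>
           (\<exists>D. (\<phi> has_real_derivative D) (at t within I) \<and> (\<rho> t)\<^sup>2 * D = c)))"

end

theory Submission
  imports Defs
begin

text \<open>
  Every trajectory is of type (c). With \<open>u = x\<^sup>2 + y\<^sup>2 > 0\<close>, the angular momentum
  \<open>c = x y' - y x'\<close> and \<open>q\<^sub>0 = z' + u / 2\<close> are first integrals. Since
  \<open>(x x' + y y')\<^sup>2 + (x y' - y x')\<^sup>2 = u (x'\<^sup>2 + y'\<^sup>2)\<close>, unit speed gives
  \<open>(u')\<^sup>2 = 4 u (1 - (q\<^sub>0 - u / 2)\<^sup>2) - 4 c\<^sup>2\<close>, a cubic in \<open>u\<close>. The angle \<open>\<phi>\<close> is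
  an antiderivative of \<open>c / u\<close>, and \<open>2 (q\<^sub>0 t - z)\<close> is one of \<open>u\<close>.
\<close>

text \<open>A derivative at \<open>t\<close> within \<open>I\<close> depends only on
  \<open>I\<close> near \<open>t\<close>, so \<open>I\<close> may be open, half-open or unbounded
  and still be replaced by a compact piece, to which the fundamental theorem of calculus applies.
  The piece also contains \<open>t0\<close>, the base point of integration.\<close>

lemma interval_locally_compact_subinterval:
  fixes I :: "real set"
  assumes "is_interval I" and "t0 \<in> I" and "t \<in> I"
  obtains a b where "a \<le> t0" "t0 \<le> b" "t \<in> {a..b}" "{a..b} \<subseteq> I"
    "at t within I = at t within {a..b}"
proof -
  have sub: "{a..b} \<subseteq> I" if "a \<in> I" "b \<in> I" for a b
    using assms(1) that by (meson atLeastAtMost_iff mem_is_interval_1_I subsetI)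
  \<comment> \<open>\<open>a\<close> lies strictly to the left of \<open>t\<close> if
    \<open>I\<close> has points there; otherwise \<open>t\<close> is the least point of
    \<open>I\<close> and serves as \<open>a\<close>. \<open>b\<close> is chosen
    symmetrically.\<close>
  obtain a where a: "a \<in> I" "a \<le> t0" "a \<le> t" "a < t \<or> (\<forall>s\<in>I. a \<le> s)"
  proof (cases "\<exists>s\<in>I. s < t")
    case True
    then obtain s where "s \<in> I" "s < t" by blast
    then show ?thesis using that[of "min s t0"] assms by (auto simp: min_def)
  next
    case False
    then show ?thesis using that[of t] assms by (force simp: not_less)
  qed
  obtain b where b: "b \<in> I" "t0 \<le> b" "t \<le> b" "t < b \<or> (\<forall>s\<in>I. s \<le> b)"
  proof (cases "\<exists>s\<in>I. t < s")
    case True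
    then obtain s where "s \<in> I" "t < s" by blast
    then show ?thesis using that[of "max s t0"] assms by (auto simp: max_def)
  next
    case False
    then show ?thesis using that[of t] assms by (force simp: not_less)
  qed
  \<comment> \<open>An open neighbourhood of \<open>t\<close> that cuts off what lies beyond
    \<open>a\<close> and \<open>b\<close>. A side with \<open>a = t\<close> or \<open>b = t\<close>
    needs no cut, since \<open>t\<close> then bounds \<open>I\<close> on that side.\<close>
  define S where "S = (if a < t then {a<..} else UNIV) \<inter> (if t < b then {..<b} else UNIV)"
  have "I \<inter> S - {t} = {a..b} \<inter> S - {t}"
    using a b sub[OF a(1) b(1)] by (force simp: S_def)
  moreover have "t \<in> S" "open S" by (auto simp: S_def)
  ultimately have "at t within I = at t within {a..b}"
    by (intro at_within_nhd)
  then show thesis using that a b sub by auto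
qed

text \<open>The oriented integral from \<open>t0\<close> works on both sides of \<open>t0\<close>;
  its derivative at each \<open>t\<close> is checked on a compact subinterval containing
  \<open>t0\<close> and \<open>t\<close>.\<close>

lemma continuous_on_interval_antiderivative:
  fixes f :: "real \<Rightarrow> real"
  assumes "is_interval I" and "continuous_on I f" and "t0 \<in> I"
  obtains F where "F t0 = F0"
    "\<And>t. t \<in> I \<Longrightarrow> (F has_real_derivative f t) (at t within I)"
proof (rule that[of "\<lambda>s. F0 + (LBINT y=t0..s. f y)"])
  show "F0 + (LBINT y=t0..t0. f y) = F0" by simp
  fix t assume "t \<in> I"
  then obtain a b where ab: "a \<le> t0" "t0 \<le> b" "t \<in> {a..b}" "{a..b} \<subseteq> I"
      "at t within I = at t within {a..b}"
    using interval_locally_compact_subinterval assms by metis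
  have "((\<lambda>s. LBINT y=t0..s. f y) has_vector_derivative f t) (at t within {a..b})"
    using ab continuous_on_subset[OF assms(2) ab(4)] by (intro interval_integral_FTC2) auto
  then have "((\<lambda>s. LBINT y=t0..s. f y) has_real_derivative f t) (at t within I)"
    by (simp add: ab has_real_derivative_iff_has_vector_derivative)
  then show "((\<lambda>s. F0 + (LBINT y=t0..s. f y)) has_real_derivative f t) (at t within I)"
    by (auto intro!: derivative_eq_intros)
qed

text \<open>Integrating the angular speed that \<open>c\<close> prescribes yields a differentiable
  angle without choosing branches of an inverse trigonometric function. The angle is correct because
  the unit radial vector and \<open>(cos \<phi>, sin \<phi>)\<close> rotate at the same speed and
  agree at \<open>t0\<close>.\<close>

lemma polar_coordinates_lift:
  fixes x y x' y' :: "real \<Rightarrow> real"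
  assumes I: "is_interval I" "t0 \<in> I"
    and dx: "\<And>t. t \<in> I \<Longrightarrow> (x has_real_derivative x' t) (at t within I)"
    and dy: "\<And>t. t \<in> I \<Longrightarrow> (y has_real_derivative y' t) (at t within I)"
    and pos: "\<And>t. t \<in> I \<Longrightarrow> (x t)\<^sup>2 + (y t)\<^sup>2 > 0"
    and c: "\<And>t. t \<in> I \<Longrightarrow> x t * y' t - y t * x' t = c"
  obtains \<phi> where
    "\<And>t. t \<in> I \<Longrightarrow> (\<phi> has_real_derivative c / ((x t)\<^sup>2 + (y t)\<^sup>2)) (at t within I)"
    "\<And>t. t \<in> I \<Longrightarrow> x t = sqrt ((x t)\<^sup>2 + (y t)\<^sup>2) * cos (\<phi> t)"
    "\<And>t. t \<in> I \<Longrightarrow> y t = sqrt ((x t)\<^sup>2 + (y t)\<^sup>2) * sin (\<phi> t)"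
proof -
  define \<rho> where "\<rho> t = sqrt ((x t)\<^sup>2 + (y t)\<^sup>2)" for t
  have \<rho>: "\<rho> t > 0" "(\<rho> t)\<^sup>2 = (x t)\<^sup>2 + (y t)\<^sup>2" if "t \<in> I" for t
    using pos[OF that] by (auto simp: \<rho>_def)
  have "continuous_on I x" "continuous_on I y"
    using dx dy by (meson DERIV_continuous continuous_on_eq_continuous_within)+
  then have cont: "continuous_on I (\<lambda>t. c / ((x t)\<^sup>2 + (y t)\<^sup>2))"
    using pos by (intro continuous_intros) force+
  \<comment> \<open>A polar angle of the point at \<open>t0\<close> becomes the constant of
    integration.\<close>
  have "(x t0 / \<rho> t0)\<^sup>2 + (y t0 / \<rho> t0)\<^sup>2 = 1"
    using \<rho>[OF I(2)] pos[OF I(2)] by (auto simp: power_divide simp flip: add_divide_distrib)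
  then obtain \<phi>0 where \<phi>0: "x t0 / \<rho> t0 = cos \<phi>0" "y t0 / \<rho> t0 = sin \<phi>0"
    using sincos_total_2pi by metis
  obtain \<phi> where \<phi>: "\<phi> t0 = \<phi>0"
    "\<And>t. t \<in> I \<Longrightarrow> (\<phi> has_real_derivative c / ((x t)\<^sup>2 + (y t)\<^sup>2)) (at t within I)"
    using continuous_on_interval_antiderivative[OF I(1) cont I(2)] by metis
  have d\<rho>: "(\<rho> has_real_derivative (x t * x' t + y t * y' t) / \<rho> t) (at t within I)"
    if "t \<in> I" for t
  proof -
    have "((\<lambda>t. (x t)\<^sup>2 + (y t)\<^sup>2) has_real_derivative 2 * (x t * x' t + y t * y' t)) (at t within I)"
      by (auto intro!: derivative_eq_intros dx dy that simp: algebra_simps)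
    from DERIV_chain2[of sqrt _ "\<lambda>t. (x t)\<^sup>2 + (y t)\<^sup>2", OF DERIV_real_sqrt[OF pos[OF that]] this]
    show ?thesis
      unfolding \<rho>_def by (rule DERIV_cong) (simp only: divide_inverse, simp)
  qed
  \<comment> \<open>The unit radial vector; the next claim is that it rotates with angular speed
    \<open>c / \<rho>\<^sup>2\<close>.\<close>
  define X Y where "X t = x t / \<rho> t" and "Y t = y t / \<rho> t" for t
  have dX: "(X has_real_derivative - (c / (\<rho> t)\<^sup>2 * Y t)) (at t within I)"
    and dY: "(Y has_real_derivative c / (\<rho> t)\<^sup>2 * X t) (at t within I)" if "t \<in> I" for t
  proof -
    \<comment> \<open>\<open>m\<close> is \<rho> times the derivative of \<rho>. The two identities
      below are the quotient-rule numerators multiplied by \<rho>; in them the radial part of the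
      velocity cancels and only the angular momentum remains.\<close>
    define m where "m = x t * x' t + y t * y' t"
    have "x' t * (\<rho> t)\<^sup>2 - x t * m = - (c * y t)" "y' t * (\<rho> t)\<^sup>2 - y t * m = c * x t"
      unfolding m_def \<rho>(2)[OF that] c[OF that, symmetric] by algebra+
    moreover have "p * \<rho> t - q * (m / \<rho> t) = (p * (\<rho> t)\<^sup>2 - q * m) / \<rho> t" for p q
      using \<rho>(1)[OF that] by (simp add: field_simps power2_eq_square)
    ultimately have "x' t * \<rho> t - x t * (m / \<rho> t) = - (c * y t) / \<rho> t"
      "y' t * \<rho> t - y t * (m / \<rho> t) = c * x t / \<rho> t"
      by simp_all
    moreover have "(X has_real_derivative (x' t * \<rho> t - x t * (m / \<rho> t)) / (\<rho> t * \<rho> t))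
        (at t within I)"
      "(Y has_real_derivative (y' t * \<rho> t - y t * (m / \<rho> t)) / (\<rho> t * \<rho> t)) (at t within I)"
      unfolding X_def[abs_def] Y_def[abs_def] m_def
      using \<rho>(1)[OF that] by (intro DERIV_divide dx dy d\<rho> that; simp)+
    ultimately show "(X has_real_derivative - (c / (\<rho> t)\<^sup>2 * Y t)) (at t within I)"
      "(Y has_real_derivative c / (\<rho> t)\<^sup>2 * X t) (at t within I)"
      by (simp_all add: X_def Y_def power2_eq_square mult.commute)
  qed
  \<comment> \<open>\<open>A\<close> and \<open>B\<close> are the scalar product and the determinant
    of \<open>(cos \<phi>, sin \<phi>)\<close> with \<open>(X, Y)\<close>, that is, the cosine and
    sine of the angle between them. Equal angular speeds make both constant.\<close>
  define A where "A t = X t * cos (\<phi> t) + Y t * sin (\<phi> t)" for t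
  define B where "B t = Y t * cos (\<phi> t) - X t * sin (\<phi> t)" for t
  have dA: "(A has_real_derivative 0) (at t within I)"
    and dB: "(B has_real_derivative 0) (at t within I)" if "t \<in> I" for t
    unfolding A_def[abs_def] B_def[abs_def]
    by (auto intro!: derivative_eq_intros dX dY \<phi>(2) that
        simp: \<rho>(2)[OF that] algebra_simps)
  have "convex I" using I(1) is_interval_convex by blast
  then have "A t = A t0" "B t = B t0" if "t \<in> I" for t
    using has_field_derivative_zero_constant[of I A] has_field_derivative_zero_constant[of I B]
      dA dB that I(2) by metis+
  moreover have "A t0 = 1" "B t0 = 0"
    using \<phi>0 \<phi>(1) sin_cos_squared_add3[of \<phi>0] by (simp_all add: A_def B_def X_def Y_def)
  ultimately have AB: "X t * cos (\<phi> t) + Y t * sin (\<phi> t) = 1"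
    "Y t * cos (\<phi> t) - X t * sin (\<phi> t) = 0" if "t \<in> I" for t
    using that by (simp_all add: A_def B_def)
  \<comment> \<open>Rotating back: \<open>X = A cos \<phi> - B sin \<phi>\<close> and
    \<open>Y = A sin \<phi> + B cos \<phi>\<close>.\<close>
  have "X t = cos (\<phi> t)" "Y t = sin (\<phi> t)" if "t \<in> I" for t
    using AB[OF that] sin_cos_squared_add3[of "\<phi> t"] by algebra+
  then have "x t = \<rho> t * cos (\<phi> t)" "y t = \<rho> t * sin (\<phi> t)" if "t \<in> I" for t
    using that \<rho>(1)[OF that] by (simp_all add: X_def Y_def divide_eq_eq mult.commute)
  then show thesis using that \<phi>(2) unfolding \<rho>_def by blast
qed

theorem mainTheorem1:
  fixes I :: "real set" and \<gamma> :: "real \<Rightarrow> real^3"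
  assumes "is_interval I" and "interior I \<noteq> {}"
    and "\<gamma> ` I \<subseteq> - Oz"
    and "normal_magnetic_trajectory (killing_magnetic_field rotation_field) I \<gamma>"
  shows "planar_curve_in_vertical_strip I \<gamma> \<or> circular_helix I \<gamma> \<or> polar_type_curve I \<gamma>"
proof -
  obtain t0 where t0: "t0 \<in> I" using assms(2) interior_subset by blast
  obtain \<gamma>' where \<gamma>':
    "\<And>t. t \<in> I \<Longrightarrow> (\<gamma> has_vector_derivative \<gamma>' t) (at t within I)"
    "\<And>t. t \<in> I \<Longrightarrow>
      (\<gamma>' has_vector_derivative cross3 (rotation_field (\<gamma> t)) (\<gamma>' t)) (at t within I)"
    "\<And>t. t \<in> I \<Longrightarrow> norm (\<gamma>' t) = 1"
    using assms(4)
    unfolding normal_magnetic_trajectory_def lorentz_force_killing_magnetic_field by blast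
  have d: "((\<lambda>s. \<gamma> s $ i) has_real_derivative \<gamma>' t $ i) (at t within I)"
    and d': "((\<lambda>s. \<gamma>' s $ i) has_real_derivative cross3 (rotation_field (\<gamma> t)) (\<gamma>' t) $ i)
      (at t within I)" if "t \<in> I" for t i
    unfolding has_real_derivative_iff_has_vector_derivative
    using bounded_linear.has_vector_derivative[OF bounded_linear_vec_nth] \<gamma>'(1,2) that by blast+
  define x y z x' y' z' where
    "x t = \<gamma> t $ 1" and "y t = \<gamma> t $ 2" and "z t = \<gamma> t $ 3" and
    "x' t = \<gamma>' t $ 1" and "y' t = \<gamma>' t $ 2" and "z' t = \<gamma>' t $ 3" for t
  have dx: "(x has_real_derivative x' t) (at t within I)"
    and dy: "(y has_real_derivative y' t) (at t within I)"
    and dz: "(z has_real_derivative z' t) (at t within I)" if "t \<in> I" for t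
    using d[OF that] by (simp_all add: x_def[abs_def] y_def[abs_def] z_def[abs_def] x'_def y'_def z'_def)
  have dx': "(x' has_real_derivative x t * z' t) (at t within I)"
    and dy': "(y' has_real_derivative y t * z' t) (at t within I)"
    and dz': "(z' has_real_derivative - (x t * x' t + y t * y' t)) (at t within I)"
    if "t \<in> I" for t
  proof -
    have "cross3 (rotation_field (\<gamma> t)) (\<gamma>' t) = vector [x t * z' t, y t * z' t,
        - (x t * x' t + y t * y' t)]"
      by (simp add: rotation_field_def cross3_def vec_eq_iff forall_3 vector_def
          x_def y_def x'_def y'_def z'_def)
    then show "(x' has_real_derivative x t * z' t) (at t within I)"
      "(y' has_real_derivative y t * z' t) (at t within I)"
      "(z' has_real_derivative - (x t * x' t + y t * y' t)) (at t within I)"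
      using d'[OF that, of 1] d'[OF that, of 2] d'[OF that, of 3]
      by (simp_all add: x'_def[abs_def] y'_def[abs_def] z'_def[abs_def])
  qed
  have speed: "(x' t)\<^sup>2 + (y' t)\<^sup>2 + (z' t)\<^sup>2 = 1" if "t \<in> I" for t
    using \<gamma>'(3)[OF that]
    by (simp add: norm_eq_1 inner_vec_def sum_3 x'_def y'_def z'_def power2_eq_square)
  define u where "u t = (x t)\<^sup>2 + (y t)\<^sup>2" for t
  have u_pos: "u t > 0" if "t \<in> I" for t
  proof (rule ccontr)
    assume "\<not> u t > 0"
    then have "x t = 0" "y t = 0"
      by (simp_all add: u_def not_less sum_power2_le_zero_iff)
    then have "\<gamma> t = 0 + z t *\<^sub>R axis 3 1"
      by (simp add: vec_eq_iff forall_3 axis_def x_def y_def z_def)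
    then have "\<gamma> t \<in> Oz" unfolding Oz_def vertical_line_def by blast
    then show False using assms(3) that by blast
  qed
  have du: "(u has_real_derivative 2 * (x t * x' t + y t * y' t)) (at t within I)"
    if "t \<in> I" for t
    unfolding u_def by (auto intro!: derivative_eq_intros dx dy that simp: algebra_simps)
  have conv: "convex I" using assms(1) is_interval_convex by blast
  \<comment> \<open>The horizontal acceleration \<open>z' (x, y)\<close> is radial, so it exerts no
    torque about the axis.\<close>
  have "((\<lambda>t. x t * y' t - y t * x' t) has_real_derivative 0) (at t within I)" if "t \<in> I" for t
    by (rule DERIV_cong[OF DERIV_diff[OF DERIV_mult[OF dx[OF that] dy'[OF that]]
          DERIV_mult[OF dy[OF that] dx'[OF that]]]]) simp
  then have "\<exists>c. \<forall>t\<in>I. x t * y' t - y t * x' t = c"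
    by (intro has_field_derivative_zero_constant conv)
  then obtain c where c: "\<And>t. t \<in> I \<Longrightarrow> x t * y' t - y t * x' t = c"
    by blast
  \<comment> \<open>The third equation of motion says that the derivative of \<open>z'\<close> is
    minus half that of \<open>u\<close>.\<close>
  have "((\<lambda>t. z' t + u t / 2) has_real_derivative 0) (at t within I)" if "t \<in> I" for t
    by (auto intro!: derivative_eq_intros du dz' that simp: field_simps)
  then have "\<exists>q. \<forall>t\<in>I. z' t + u t / 2 = q"
    by (intro has_field_derivative_zero_constant conv)
  then obtain q where "\<And>t. t \<in> I \<Longrightarrow> z' t + u t / 2 = q"
    by blast
  then have q: "z' t = q - u t / 2" if "t \<in> I" for t
    using that by (simp add: eq_diff_eq)
  obtain \<phi> where \<phi>:
    "\<And>t. t \<in> I \<Longrightarrow> (\<phi> has_real_derivative c / u t) (at t within I)"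
    "\<And>t. t \<in> I \<Longrightarrow> x t = sqrt (u t) * cos (\<phi> t)"
    "\<And>t. t \<in> I \<Longrightarrow> y t = sqrt (u t) * sin (\<phi> t)"
    using polar_coordinates_lift[OF assms(1) t0 dx dy u_pos[unfolded u_def] c]
    unfolding u_def by blast
  \<comment> \<open>The expansion of \<open>4 u ((q - u / 2)\<^sup>2 - 1) + 4 c\<^sup>2\<close> in
    powers of \<open>u\<close>. Its leading coefficient is 1, so the degree is 3 for all values of
    \<open>q\<close> and \<open>c\<close>.\<close>
  define P where "P = [:4 * c\<^sup>2, 4 * (q\<^sup>2 - 1), - 4 * q, 1:]"
  have cubic: "(2 * (x t * x' t + y t * y' t))\<^sup>2 + poly P (u t) = 0" if "t \<in> I" for t
  proof -
    have "(x t * x' t + y t * y' t)\<^sup>2 = u t * ((x' t)\<^sup>2 + (y' t)\<^sup>2) - c\<^sup>2"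
      unfolding u_def c[OF that, symmetric] by algebra
    also have "(x' t)\<^sup>2 + (y' t)\<^sup>2 = 1 - (q - u t / 2)\<^sup>2"
      using speed[OF that] q[OF that] by simp
    finally show ?thesis
      by (simp add: P_def power_mult_distrib) (simp add: power2_eq_square field_simps)
  qed
  \<comment> \<open>Valid for every real \<open>t\<close>, hence usable for rewriting under the
    \<lambda> of the function to be differentiated.\<close>
  have u_sq: "(sqrt (u t))\<^sup>2 = u t" for t by (simp add: u_def)
  have "polar_type_curve I \<gamma>"
    unfolding polar_type_curve_def
  \<comment> \<open>The witnesses are \<open>sqrt (u t)\<close> for \<rho>, the lifted angle \<phi>,
    and \<open>R s = 2 * (q * s - z s)\<close>, obtained by solving the required formula for the
    third coordinate.\<close>
  proof (intro exI conjI ballI)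
    show "degree P = 3" by (simp add: P_def)
    fix t assume t: "t \<in> I"
    show "sqrt (u t) > 0" using u_pos[OF t] by simp
    show "\<gamma> t $ 1 = sqrt (u t) * cos (\<phi> t)" using \<phi>(2)[OF t] by (simp add: x_def)
    show "\<gamma> t $ 2 = sqrt (u t) * sin (\<phi> t)" using \<phi>(3)[OF t] by (simp add: y_def)
    show "((\<lambda>s. 2 * (q * s - z s)) has_real_derivative (sqrt (u t))\<^sup>2) (at t within I)"
      unfolding u_sq by (auto intro!: derivative_eq_intros dz t simp: q[OF t])
    show "\<gamma> t $ 3 = q * t - 2 * (q * t - z t) / 2" by (simp add: z_def field_simps)
    show "((\<lambda>s. (sqrt (u s))\<^sup>2) has_real_derivative 2 * (x t * x' t + y t * y' t)) (at t within I)"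
      unfolding u_sq by (rule du[OF t])
    show "(2 * (x t * x' t + y t * y' t))\<^sup>2 + poly P ((sqrt (u t))\<^sup>2) = 0"
      unfolding u_sq by (rule cubic[OF t])
    show "(\<phi> has_real_derivative c / u t) (at t within I)" by (rule \<phi>(1)[OF t])
    show "(sqrt (u t))\<^sup>2 * (c / u t) = c" unfolding u_sq using u_pos[OF t] by simp
  qed
  then show ?thesis by blast
qed

end
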